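(* Let $G$ be a finite simple graph with $|G|\geq 3$ vertices which is at most simply connected, and let $S$ be a finite non-empty set of primes. If $G$ is representable with $S$, then $G$ is infinitely representable with $S$.
   Context: A graph $G$ is doubly connected if after deleting any edge of $G$ the graph obtained is connected; $G$ is at most simply connected if it is not doubly connected. For a finite non-empty set $S$ of primes, $\mathbb{Z}_S$ is the ring of those rationals whose denominators (in lowest terms) are not divisible by primes outside $S$, and $\mathbb{Z}_S^*$ is its multiplicative group of invertible elements ($S$-units). For a subset $A$ of $\mathbb{Z}_S$, $\mathcal{G}_S(A)$ is the graph with vertex set $A$ in which two vertices $a,b\in A$ are joined by an edge if and only if $a-b\in\mathbb{Z}_S^*$. Ordered subsets $A$ and $A'$ of $\mathbb{Z}_S$ are $S$-equivalent if $A'=uA+b$ for some $u\in\mathbb{Z}_S^*$ and $b\in\mathbb{Z}_S$. A finite graph $G$ is representable with $S$ if $G$ is isomorphic to $\mathcal{G}_S(A)$ for some finite $A\subseteq\mathbb{Z}_S$, and infinitely representable with $S$ if this holds for infinitely many pairwise non-$S$-equivalent $A$. *)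

theory Defs
  imports Complex_Main "HOL-Computational_Algebra.Primes" "Graph_Theory.Graph_Theory"
begin

text \<open>
  A finite simple graph is a \<^locale>\<open>pair_graph\<close>: a finite, symmetric, loop-free digraph whose arcs
  are pairs of vertices.  An undirected edge is therefore a pair of opposite arcs, and deleting it
  must remove both of them: the connectedness predicate of the library symmetrises the
  digraph first, so deleting a single arc would have no effect on it.
\<close>

definition del_edge :: "'a pair_pre_digraph \<Rightarrow> 'a \<times> 'a \<Rightarrow> 'a pair_pre_digraph" where
  "del_edge G e = G \<lparr> parcs := parcs G - {(fst e, snd e), (snd e, fst e)} \<rparr>"

text \<open>
  The first conjunct matters only for edgeless graphs: as soon as there is an edge, it follows from
  the second (lemma below).  It prevents an edgeless graph, which is disconnected if it has at
  least two vertices, from being doubly connected vacuously.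
\<close>

definition doubly_connected :: "'a pair_pre_digraph \<Rightarrow> bool" where
  "doubly_connected G \<longleftrightarrow>
     Digraph_Component.connected (with_proj G) \<and>
     (\<forall>e \<in> parcs G. Digraph_Component.connected (with_proj (del_edge G e)))"

definition at_most_simply_connected :: "'a pair_pre_digraph \<Rightarrow> bool" where
  "at_most_simply_connected G \<longleftrightarrow> \<not> doubly_connected G"

lemma doubly_connected_iff_del_edge:
  assumes "parcs G \<noteq> {}"
  shows "doubly_connected G \<longleftrightarrow>
    (\<forall>e \<in> parcs G. Digraph_Component.connected (with_proj (del_edge G e)))"
proof -
  have "Digraph_Component.connected (with_proj G)"
    if c: "Digraph_Component.connected (with_proj (del_edge G e))" for e
  proof -
    let ?D = "with_proj (mk_symmetric (with_proj (del_edge G e)))"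
    let ?H = "with_proj (mk_symmetric (with_proj G))"
    have V: "verts ?D = verts ?H"
      by (simp add: mk_symmetric_def del_edge_def)
    have sub: "arcs_ends ?D \<subseteq> arcs_ends ?H"
      by (auto simp: mk_symmetric_def del_edge_def)
    have reach: "u \<rightarrow>\<^sup>*\<^bsub>?H\<^esub> v" if "u \<rightarrow>\<^sup>*\<^bsub>?D\<^esub> v" for u v
      using rtrancl_on_mono[OF sub equalityD1[OF V] that[unfolded reachable_def]]
      unfolding reachable_def .
    show ?thesis
      using c reach V unfolding Digraph_Component.connected_def strongly_connected_def by metis
  qed
  with assms show ?thesis unfolding doubly_connected_def by blast
qed

text \<open>\<^term>\<open>quotient_of q\<close> is the pair of numerator and positive denominator of \<open>q\<close> in lowest terms.\<close>

definition S_integers :: "nat set \<Rightarrow> rat set" where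
  "S_integers S = {q. \<forall>p::nat. prime p \<and> int p dvd snd (quotient_of q) \<longrightarrow> p \<in> S}"

definition S_units :: "nat set \<Rightarrow> rat set" where
  "S_units S = {u \<in> S_integers S. \<exists>v \<in> S_integers S. u * v = 1}"

definition S_graph :: "nat set \<Rightarrow> rat set \<Rightarrow> rat pair_pre_digraph" where
  "S_graph S A = \<lparr> pverts = A, parcs = {(a, b). a \<in> A \<and> b \<in> A \<and> a - b \<in> S_units S} \<rparr>"

definition represents :: "nat set \<Rightarrow> 'a pair_pre_digraph \<Rightarrow> rat set \<Rightarrow> bool" where
  "represents S G A \<longleftrightarrow>
     finite A \<and> A \<subseteq> S_integers S \<and> digraph_iso (with_proj G) (with_proj (S_graph S A))"

definition representable :: "nat set \<Rightarrow> 'a pair_pre_digraph \<Rightarrow> bool" where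
  "representable S G \<longleftrightarrow> (\<exists>A. represents S G A)"

text \<open>
  Equivalence is a relation between ordered subsets, which are rendered as lists without
  repetitions.  Distinct orderings of the same finite set may be inequivalent, but since each
  finite set has only finitely many orderings, this does not affect whether there are infinitely
  many pairwise inequivalent representations.
\<close>

definition S_equivalent :: "nat set \<Rightarrow> rat list \<Rightarrow> rat list \<Rightarrow> bool" where
  "S_equivalent S A A' \<longleftrightarrow>
     (\<exists>u \<in> S_units S. \<exists>b \<in> S_integers S. A' = map (\<lambda>a. u * a + b) A)"

definition infinitely_representable :: "nat set \<Rightarrow> 'a pair_pre_digraph \<Rightarrow> bool" where
  "infinitely_representable S G \<longleftrightarrow>
     (\<exists>\<A> :: rat list set. infinite \<A> \<and>
        (\<forall>A \<in> \<A>. distinct A \<and> represents S G (set A)) \<and>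
        pairwise (\<lambda>A A'. \<not> S_equivalent S A A') \<A>)"

end

theory Submission
  imports Defs
begin

text \<open>
  A graph that is not doubly connected splits into two non-empty sides \<open>U\<close> and \<open>W\<close> with at most one
  edge between them: if the graph is disconnected, no edge crosses, and otherwise the crossing edge
  is a bridge.  Choose \<open>x\<close> in \<open>U\<close> and \<open>y\<close> in \<open>W\<close> so that \<open>xy\<close> is the crossing edge if there is one
  (\<open>at_most_simply_connected_imp_cut\<close>).  Within each side, adjacency survives translation by an
  \<open>S\<close>-integer and multiplication by an \<open>S\<close>-unit, so a representation \<open>f\<close> may be replaced by
  \<open>f v - f x\<close> on \<open>U\<close> and \<open>w (f v - f y) + b\<close> on \<open>W\<close>, provided that the differences across the cut
  behave correctly (\<open>realizes_glue\<close>).  These differences are \<open>c + b\<close> for \<open>c\<close> in a finite set of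
  \<open>S\<close>-integers, and \<open>c = 0\<close> occurs at the pair \<open>(x, y)\<close>.  A suitable unit \<open>w\<close> makes
  \<open>c\<close> nonzero at all other crossing pairs.

  It remains to find infinitely many \<open>b\<close> for which \<open>c + b\<close> is neither zero nor a unit at these other
  pairs.  Let \<open>P\<close> be the product of \<open>S\<close> and
  \<open>b = m / P^k\<close> with \<open>m\<close> prime to \<open>P\<close>.  For large \<open>k\<close> the number \<open>P^k (c + b) = m + P^k c\<close> is an
  integer congruent to \<open>m\<close> modulo \<open>P\<close>, hence prime to \<open>S\<close>, and so it can only be a unit if it
  is 1 or -1.  If \<open>c\<close> is nonzero this is impossible by size; if \<open>c = 0\<close> it happens exactly for
  \<open>m = 1\<close> or \<open>m = -1\<close> (\<open>eventually_shift_not_S_unit\<close>).  Taking \<open>m = 1\<close> keeps the edge \<open>xy\<close> of a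
  bridge, and \<open>m = P + 1\<close> keeps \<open>x\<close> and \<open>y\<close> apart when no edge crosses.

  With at least three vertices, one side contains two points, whose difference does not depend on
  \<open>b\<close>.  An equivalence between two of the new representations preserves this difference and the
  label 0 of \<open>x\<close>, so it is the identity, and different \<open>b\<close> give inequivalent representations.
\<close>

section \<open>Arithmetic of S-integers and S-units\<close>

lemma dvd_power_Prod_if_prime_factors_in:
  fixes d :: nat
  assumes S: "finite S" and "d > 0" and "\<And>p. prime p \<Longrightarrow> p dvd d \<Longrightarrow> p \<in> S"
  shows "\<exists>n. d dvd \<Prod>S ^ n"
  using assms(2,3)
proof (induction d rule: less_induct)
  case (less d)
  show ?case
  proof (cases "d = 1")
    case False
    then obtain p where p: "prime p" "p dvd d"
      using prime_factor_nat by blast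
    then obtain d' where d': "d = p * d'"
      by blast
    have "d' < d" "d' > 0"
      using p less.prems(1) prime_gt_1_nat[of p] by (auto simp: d')
    then obtain n where "d' dvd \<Prod>S ^ n"
      using less.IH[of d'] less.prems(2) by (auto simp: d')
    moreover have "p dvd \<Prod>S"
      using p less.prems(2) S by auto
    ultimately have "d dvd \<Prod>S ^ Suc n"
      by (simp add: d' mult_dvd_mono)
    then show ?thesis ..
  qed auto
qed

text \<open>
  Powers of the single integer \<open>\<Prod>S\<close> serve as common denominators, which makes the ring structure and
  all later divisibility arguments a matter of integer arithmetic.
\<close>

lemma S_integers_iff:
  assumes S: "finite S" "\<forall>p\<in>S. prime p"
  shows "q \<in> S_integers S \<longleftrightarrow> (\<exists>n z. of_nat (\<Prod>S) ^ n * q = of_int z)"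
proof -
  obtain a b where ab: "quotient_of q = (a, b)"
    by (cases "quotient_of q")
  have b: "b > 0" and q: "q = of_int a / of_int b" and cop: "coprime a b"
    using quotient_of_denom_pos[OF ab] quotient_of_div[OF ab] quotient_of_coprime[OF ab] by auto
  have in_iff: "q \<in> S_integers S \<longleftrightarrow> (\<forall>p. prime p \<and> int p dvd b \<longrightarrow> p \<in> S)"
    by (simp add: S_integers_def ab)
  show ?thesis
  proof
    assume "q \<in> S_integers S"
    then have "p \<in> S" if "prime p" "p dvd nat b" for p
      using that b in_iff by (simp add: int_dvd_int_iff[symmetric])
    then obtain n where "nat b dvd \<Prod>S ^ n"
      using dvd_power_Prod_if_prime_factors_in[of S "nat b"] S b by auto
    then have "b dvd int (\<Prod>S) ^ n"
      using b by (simp add: nat_dvd_iff)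
    then obtain t where t: "int (\<Prod>S) ^ n = b * t"
      by blast
    have "of_nat (\<Prod>S) ^ n * q = of_int (int (\<Prod>S) ^ n) * q"
      by simp
    also have "\<dots> = of_int (t * a)"
      using b unfolding t by (simp add: q)
    finally show "\<exists>n z. of_nat (\<Prod>S) ^ n * q = of_int z"
      by blast
  next
    assume "\<exists>n z. of_nat (\<Prod>S) ^ n * q = of_int z"
    then obtain n z where nz: "of_nat (\<Prod>S) ^ n * q = of_int z"
      by blast
    then have "(of_int (int (\<Prod>S) ^ n * a) :: rat) = of_int (z * b)"
      using b by (simp add: q field_simps)
    then have "int (\<Prod>S) ^ n * a = z * b"
      by (simp only: of_int_eq_iff)
    then have "b dvd int (\<Prod>S) ^ n"
      using cop by (metis coprime_commute coprime_dvd_mult_left_iff dvd_triv_right)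
    moreover have "p \<in> S" if p: "prime p" "int p dvd int (\<Prod>S) ^ n" for p
    proof -
      have "p dvd \<Prod>S"
        using p by (metis int_dvd_int_iff of_nat_power prime_dvd_power)
      then obtain s where "s \<in> S" "p dvd s"
        using p(1) S(1) by (auto simp: prime_dvd_prod_iff)
      then show ?thesis
        using S(2) p(1) primes_dvd_imp_eq by blast
    qed
    ultimately show "q \<in> S_integers S"
      unfolding in_iff by (meson dvd_trans)
  qed
qed

context
  fixes S :: "nat set"
  assumes S: "finite S" "\<forall>p\<in>S. prime p"
begin

lemma Prod_pos: "\<Prod>S > 0"
  using S by (auto intro!: prod_pos simp: prime_gt_0_nat)

lemma Prod_ge_2:
  assumes "S \<noteq> {}"
  shows "\<Prod>S \<ge> 2"
proof -
  obtain p where "p \<in> S"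
    using assms by blast
  then have "p \<le> \<Prod>S" "p \<ge> 2"
    using S Prod_pos dvd_prodI[of S p id] by (auto simp: dvd_imp_le prime_ge_2_nat)
  then show ?thesis
    by linarith
qed

lemma of_int_S_integer: "of_int z \<in> S_integers S"
  unfolding S_integers_iff[OF S] by (rule exI[of _ 0]) simp

lemma S_integer_mult:
  assumes "x \<in> S_integers S" "y \<in> S_integers S"
  shows "x * y \<in> S_integers S"
proof -
  obtain m a n b where "of_nat (\<Prod>S) ^ m * x = of_int a" "of_nat (\<Prod>S) ^ n * y = of_int b"
    using assms unfolding S_integers_iff[OF S] by blast
  then have "of_nat (\<Prod>S) ^ (m + n) * (x * y) = of_int (a * b)"
    by (simp add: power_add mult_ac flip: of_int_mult) (metis mult.assoc mult.left_commute of_int_mult)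
  then show ?thesis
    unfolding S_integers_iff[OF S] by blast
qed

lemma S_integer_add:
  assumes "x \<in> S_integers S" "y \<in> S_integers S"
  shows "x + y \<in> S_integers S"
proof -
  obtain m a n b where eq: "of_nat (\<Prod>S) ^ m * x = of_int a" "of_nat (\<Prod>S) ^ n * y = of_int b"
    using assms unfolding S_integers_iff[OF S] by blast
  have "of_nat (\<Prod>S) ^ (m + n) * (x + y) =
      of_nat (\<Prod>S) ^ n * (of_nat (\<Prod>S) ^ m * x) + of_nat (\<Prod>S) ^ m * (of_nat (\<Prod>S) ^ n * y)"
    by (simp add: power_add algebra_simps)
  also have "\<dots> = of_int (int (\<Prod>S) ^ n * a + int (\<Prod>S) ^ m * b)"
    unfolding eq by simp
  finally show ?thesis
    unfolding S_integers_iff[OF S] by blast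
qed

lemma S_integer_diff:
  assumes "x \<in> S_integers S" "y \<in> S_integers S"
  shows "x - y \<in> S_integers S"
  using S_integer_add[OF assms(1) S_integer_mult[OF of_int_S_integer[of "-1"] assms(2)]] by simp

lemma S_unit_mult:
  assumes "u \<in> S_units S" "v \<in> S_units S"
  shows "u * v \<in> S_units S"
proof -
  obtain u' v' where "u' \<in> S_integers S" "v' \<in> S_integers S" "u * u' = 1" "v * v' = 1"
    using assms unfolding S_units_def by blast
  then have "u' * v' \<in> S_integers S" "(u * v) * (u' * v') = 1"
    by (auto simp: S_integer_mult) (metis mult.assoc mult.left_commute mult_1_right)
  with assms show ?thesis
    unfolding S_units_def by (auto simp: S_integer_mult)
qed

lemma S_unit_inverse:
  assumes "u \<in> S_units S"
  shows "inverse u \<in> S_units S" and "u \<noteq> 0"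
proof -
  obtain v where v: "u \<in> S_integers S" "v \<in> S_integers S" "u * v = 1"
    using assms unfolding S_units_def by blast
  then show "u \<noteq> 0"
    by auto
  have "inverse u = v" "v * u = 1"
    using v(3) by (auto simp: inverse_unique mult.commute)
  with v show "inverse u \<in> S_units S"
    unfolding S_units_def by auto
qed

lemma S_unit_mult_cancel:
  assumes "w \<in> S_units S"
  shows "w * x \<in> S_units S \<longleftrightarrow> x \<in> S_units S"
proof
  assume "w * x \<in> S_units S"
  then have "inverse w * (w * x) \<in> S_units S"
    by (rule S_unit_mult[OF S_unit_inverse(1)[OF assms]])
  moreover have "inverse w * (w * x) = x"
    using S_unit_inverse(2)[OF assms] by (simp add: field_simps)
  ultimately show "x \<in> S_units S"
    by simp
qed (use assms S_unit_mult in blast)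

lemma S_unit_uminus: "- x \<in> S_units S \<longleftrightarrow> x \<in> S_units S"
proof -
  have "-1 \<in> S_units S"
    unfolding S_units_def using of_int_S_integer[of "-1"] by auto
  from S_unit_mult_cancel[OF this, of x] show ?thesis
    by simp
qed

lemma Prod_power_S_unit: "of_nat (\<Prod>S) ^ k \<in> S_units S"
proof -
  have "(1 / of_nat (\<Prod>S) ^ k :: rat) \<in> S_integers S"
    unfolding S_integers_iff[OF S] using Prod_pos
    by (intro exI[of _ k] exI[of _ 1]) (simp del: of_nat_prod)
  moreover have "(of_nat (\<Prod>S) ^ k :: rat) \<in> S_integers S"
    using of_int_S_integer[of "int (\<Prod>S) ^ k"] by simp
  ultimately show ?thesis
    unfolding S_units_def using Prod_pos
    by (simp del: of_nat_prod) (rule bexI[of _ "1 / of_nat (\<Prod>S) ^ k"], simp_all del: of_nat_prod)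
qed

text \<open>An integer that is an \<open>S\<close>-unit divides a power of \<open>\<Prod>S\<close>.\<close>

lemma S_unit_coprime_imp_abs_eq_1:
  assumes "of_int t \<in> S_units S" "coprime t (int (\<Prod>S))"
  shows "\<bar>t\<bar> = 1"
proof -
  obtain v where v: "v \<in> S_integers S" "of_int t * v = 1"
    using assms unfolding S_units_def by blast
  then obtain n z where "of_nat (\<Prod>S) ^ n * v = of_int z"
    unfolding S_integers_iff[OF S] by blast
  then have "(of_int (t * z) :: rat) = of_int (int (\<Prod>S) ^ n)"
    using v(2) by (metis (no_types, lifting) mult.left_commute mult.right_neutral of_int_mult
        of_int_of_nat_eq of_int_power)
  then have "t dvd int (\<Prod>S) ^ n"
    unfolding of_int_eq_iff by (metis dvd_triv_left)
  then show ?thesis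
    using assms(2) by (meson coprime_absorb_left coprime_power_right_iff zdvd1_eq)
qed

text \<open>
  The sum \<open>c + m / P^k\<close> has numerator \<open>m + P^k c\<close> up to a unit.  Once \<open>k\<close> exceeds the exponent needed
  to clear the denominator of \<open>c\<close>, this is an integer congruent to \<open>m\<close> modulo \<open>P\<close>, hence
  nonzero and a unit only if it is 1 or -1.  Growth of \<open>P^k\<close> excludes these values when \<open>c\<close> is nonzero.
\<close>

lemma eventually_shift_not_S_unit:
  assumes "S \<noteq> {}" "c \<in> S_integers S" "coprime m (int (\<Prod>S))" "c \<noteq> 0 \<or> \<bar>m\<bar> \<noteq> 1"
  shows "\<forall>\<^sub>F k in sequentially.
    c + of_int m / of_nat (\<Prod>S) ^ k \<notin> S_units S \<and> c + of_int m / of_nat (\<Prod>S) ^ k \<noteq> 0"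
proof -
  let ?P = "int (\<Prod>S)"
  have P: "?P \<ge> 2"
    using Prod_ge_2[OF assms(1)] by linarith
  obtain n z where nz: "of_nat (\<Prod>S) ^ n * c = of_int z"
    using assms(2) unfolding S_integers_iff[OF S] by blast
  \<comment> \<open>The excess of \<open>k\<close> over \<open>n\<close> must be positive for the congruence modulo \<open>P\<close>, and large enough
    that \<open>2 ^ (k - n)\<close> is greater than \<open>\<bar>m\<bar> + 1\<close>.\<close>
  have "c + of_int m / of_nat (\<Prod>S) ^ k \<notin> S_units S \<and> c + of_int m / of_nat (\<Prod>S) ^ k \<noteq> 0"
    if k: "k \<ge> n + nat \<bar>m\<bar> + 2" for k
  proof -
    define j where "j = k - n"
    have kj: "k = n + j" and j: "j \<ge> nat \<bar>m\<bar> + 2"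
      using k by (auto simp: j_def)
    define t where "t = m + ?P ^ j * z"
    have scale: "of_nat (\<Prod>S) ^ k * (c + of_int m / of_nat (\<Prod>S) ^ k) = of_int t"
    proof -
      have "of_nat (\<Prod>S) ^ k * (c + of_int m / of_nat (\<Prod>S) ^ k) =
          of_nat (\<Prod>S) ^ j * (of_nat (\<Prod>S) ^ n * c) + of_int m"
        using Prod_pos by (simp add: distrib_left del: of_nat_prod) (simp add: kj power_add)
      then show ?thesis
        unfolding nz by (simp add: t_def)
    qed
    have cop: "coprime t ?P"
    proof -
      have "j = Suc (j - 1)"
        using j by simp
      then have "t = m + ?P * (?P ^ (j - 1) * z)"
        unfolding t_def by (metis mult.assoc power_Suc)
      then show ?thesis
        using assms(3) by (metis coprime_iff_gcd_eq_1 gcd.commute gcd_add_mult mult.commute add.commute)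
    qed
    have "\<bar>t\<bar> \<noteq> 1"
    proof (cases "z = 0")
      case True
      then have "c = 0"
        using nz Prod_pos by (simp del: of_nat_prod)
      then show ?thesis
        using assms(4) True by (simp add: t_def)
    next
      case False
      have "int j < 2 ^ j"
        using of_nat_less_two_power by blast
      also have "(2 :: int) ^ j \<le> ?P ^ j"
        using P by (intro power_mono) auto
      also have "\<dots> \<le> \<bar>?P ^ j * z\<bar>"
        using False P by (simp add: abs_mult)
      finally show ?thesis
        using j unfolding t_def by linarith
    qed
    then have "of_int t \<notin> S_units S"
      using S_unit_coprime_imp_abs_eq_1 cop by blast
    moreover have "t \<noteq> 0"
      using cop P by auto
    ultimately show ?thesis
      using S_unit_mult_cancel[OF Prod_power_S_unit] scale
      by (metis mult_zero_right of_int_eq_0_iff)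
  qed
  then show ?thesis
    unfolding eventually_sequentially by blast
qed

end

section \<open>Cuts of graphs that are not doubly connected\<close>

text \<open>
  One side of the cut is the set of vertices reachable from a vertex that does not reach everything.
  The conclusion speaks of arcs from \<open>U\<close> to \<open>W\<close> only, which for a symmetric digraph covers both
  directions.
\<close>

lemma not_connected_imp_cut:
  assumes "\<not> Digraph_Component.connected (with_proj H)" "pverts H \<noteq> {}"
  obtains U W where "U \<noteq> {}" "W \<noteq> {}" "U \<union> W = pverts H" "U \<inter> W = {}"
    "\<And>u w. u \<in> U \<Longrightarrow> w \<in> W \<Longrightarrow> (u, w) \<notin> parcs H"
proof -
  let ?D = "with_proj (mk_symmetric (with_proj H))"
  obtain a b where ab: "a \<in> pverts H" "b \<in> pverts H" "\<not> a \<rightarrow>\<^sup>*\<^bsub>?D\<^esub> b"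
    using assms unfolding Digraph_Component.connected_def strongly_connected_def by auto
  define U where "U = {u \<in> pverts H. a \<rightarrow>\<^sup>*\<^bsub>?D\<^esub> u}"
  have "a \<in> U" "b \<in> pverts H - U"
    using ab by (auto simp: U_def reachable_def)
  moreover have "(u, w) \<notin> parcs H" if "u \<in> U" "w \<in> pverts H - U" for u w
  proof
    assume "(u, w) \<in> parcs H"
    then have "(u, w) \<in> arcs_ends ?D"
      by (force simp: parcs_mk_symmetric)
    with that have "a \<rightarrow>\<^sup>*\<^bsub>?D\<^esub> w"
      unfolding U_def reachable_def by (auto intro: rtrancl_on_into_rtrancl_on)
    with that show False
      by (simp add: U_def)
  qed
  ultimately show thesis
    using that[of U "pverts H - U"] by (auto simp: U_def)
qed

text \<open>
  Both ways of failing to be doubly connected yield a disconnected graph that lacks at most one edge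
  \<open>ab\<close> of \<open>G\<close>.  A cut of that graph is crossed in \<open>G\<close> by \<open>ab\<close> at most, and if it is not,
  then \<open>x\<close> and \<open>y\<close> may be arbitrary.
\<close>

lemma at_most_simply_connected_imp_cut:
  assumes "at_most_simply_connected G" "pverts G \<noteq> {}"
  obtains U W x y where "x \<in> U" "y \<in> W" "U \<union> W = pverts G" "U \<inter> W = {}"
    "\<forall>u\<in>U. \<forall>w\<in>W. (u, w) \<in> parcs G \<longrightarrow> u = x \<and> w = y"
proof -
  obtain H a b where H: "\<not> Digraph_Component.connected (with_proj H)" "pverts H = pverts G"
    "parcs G \<subseteq> parcs H \<union> {(a, b), (b, a)}"
  proof (cases "Digraph_Component.connected (with_proj G)")
    case True
    then obtain e where "\<not> Digraph_Component.connected (with_proj (del_edge G e))"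
      using assms(1) unfolding at_most_simply_connected_def doubly_connected_def by blast
    then show thesis
      by (rule that[of _ "fst e" "snd e"]) (auto simp: del_edge_def)
  qed (use that in blast)
  obtain U W where cut: "U \<noteq> {}" "W \<noteq> {}" "U \<union> W = pverts G" "U \<inter> W = {}"
    "\<And>u w. u \<in> U \<Longrightarrow> w \<in> W \<Longrightarrow> (u, w) \<notin> parcs H"
    using not_connected_imp_cut[OF H(1)] assms(2) H(2) by metis
  have crossing: "(u, w) = (a, b) \<or> (u, w) = (b, a)"
    if "u \<in> U" "w \<in> W" "(u, w) \<in> parcs G" for u w
    using H(3) cut(5)[of u w] that by auto
  consider "a \<in> U" "b \<in> W" | "b \<in> U" "a \<in> W" | "\<not> (a \<in> U \<and> b \<in> W)" "\<not> (b \<in> U \<and> a \<in> W)"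
    by blast
  then show thesis
  proof cases
    case 1
    then show thesis
      using that[of a U b W] cut(3,4) crossing by blast
  next
    case 2
    then show thesis
      using that[of b U a W] cut(3,4) crossing by blast
  next
    case 3
    obtain x y where "x \<in> U" "y \<in> W"
      using cut(1,2) by blast
    then show thesis
      using that[of x U y W] cut(3,4) crossing 3 by blast
  qed
qed

section \<open>Representations as maps on the vertex set\<close>

text \<open>
  Describing a representation by its vertex labelling, rather than by the set of labels, makes it
  possible to modify the two sides of a cut separately and to order all representations by the same
  list of vertices.
\<close>

definition realizes :: "nat set \<Rightarrow> 'a pair_pre_digraph \<Rightarrow> ('a \<Rightarrow> rat) \<Rightarrow> bool" where
  "realizes S G f \<longleftrightarrow> inj_on f (pverts G) \<and> f ` pverts G \<subseteq> S_integers S \<and>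
     (\<forall>u \<in> pverts G. \<forall>v \<in> pverts G. (u, v) \<in> parcs G \<longleftrightarrow> f u - f v \<in> S_units S)"

text \<open>
  Arcs are pairs of vertices in both digraphs, so an isomorphism is determined by its action on
  vertices.
\<close>

lemma represents_iff_realizes:
  assumes "pair_fin_digraph G"
  shows "represents S G A \<longleftrightarrow> (\<exists>f. realizes S G f \<and> A = f ` pverts G)"
proof
  interpret pair_fin_digraph G by fact
  assume "represents S G A"
  then obtain h where A: "A \<subseteq> S_integers S"
    and iso: "digraph_isomorphism h"
    and app: "with_proj (S_graph S A) = app_iso h (with_proj G)"
    unfolding represents_def digraph_iso_def by blast
  define f where "f = iso_verts h"
  have inj: "inj_on f (pverts G)"
    using iso unfolding digraph_isomorphism_def f_def by auto
  have verts: "A = f ` pverts G"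
    using arg_cong[OF app, of verts] by (simp add: S_graph_def f_def)
  have ends: "iso_arcs h e = (f (fst e), f (snd e))" if "e \<in> parcs G" for e
    using iso that arg_cong[OF app, of tail] arg_cong[OF app, of head]
    unfolding digraph_isomorphism_def f_def by (auto simp: prod_eq_iff)
  have "parcs (S_graph S A) = iso_arcs h ` parcs G"
    using arg_cong[OF app, of arcs] by simp
  also have "\<dots> = (\<lambda>e. (f (fst e), f (snd e))) ` parcs G"
    using ends by (rule image_cong[OF refl])
  finally have arcs: "parcs (S_graph S A) = (\<lambda>e. (f (fst e), f (snd e))) ` parcs G" .
  have "(u, v) \<in> parcs G \<longleftrightarrow> f u - f v \<in> S_units S" if uv: "u \<in> pverts G" "v \<in> pverts G" for u v
  proof -
    have "(u, v) \<in> parcs G \<longleftrightarrow> (f u, f v) \<in> parcs (S_graph S A)"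
      unfolding arcs using uv inj by (force simp: inj_on_eq_iff wellformed')
    then show ?thesis
      using uv by (simp add: S_graph_def verts)
  qed
  with inj A verts show "\<exists>f. realizes S G f \<and> A = f ` pverts G"
    unfolding realizes_def by blast
next
  interpret pair_fin_digraph G by fact
  assume "\<exists>f. realizes S G f \<and> A = f ` pverts G"
  then obtain f where f: "inj_on f (pverts G)" "f ` pverts G \<subseteq> S_integers S" "A = f ` pverts G"
    "\<And>u v. u \<in> pverts G \<Longrightarrow> v \<in> pverts G \<Longrightarrow> (u, v) \<in> parcs G \<longleftrightarrow> f u - f v \<in> S_units S"
    unfolding realizes_def by blast
  define h where "h = \<lparr>iso_verts = f, iso_arcs = map_prod f f, iso_head = snd, iso_tail = fst\<rparr>"
  have "inj_on (map_prod f f) (parcs G)"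
  proof (rule inj_on_subset)
    show "inj_on (map_prod f f) (pverts G \<times> pverts G)"
      using map_prod_inj_on[OF f(1) f(1)] .
    show "parcs G \<subseteq> pverts G \<times> pverts G"
      using wellformed' by auto
  qed
  then have "digraph_isomorphism h"
    unfolding digraph_isomorphism_def using f(1) wf_digraph_axioms by (auto simp: h_def)
  moreover have "with_proj (S_graph S A) = app_iso h (with_proj G)"
  proof -
    have "(a, b) \<in> map_prod f f ` parcs G \<longleftrightarrow> a \<in> A \<and> b \<in> A \<and> a - b \<in> S_units S" for a b
    proof
      assume "(a, b) \<in> map_prod f f ` parcs G"
      then obtain u v where "(u, v) \<in> parcs G" "a = f u" "b = f v"
        by auto
      then show "a \<in> A \<and> b \<in> A \<and> a - b \<in> S_units S"
        using f(4)[of u v] wellformed'[of u v] by (simp add: f(3))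
    next
      assume "a \<in> A \<and> b \<in> A \<and> a - b \<in> S_units S"
      then obtain u v where "u \<in> pverts G" "v \<in> pverts G" "a = f u" "b = f v" "f u - f v \<in> S_units S"
        unfolding f(3) by blast
      then show "(a, b) \<in> map_prod f f ` parcs G"
        using f(4)[of u v] by (auto intro: map_prod_imageI)
    qed
    then have "parcs (S_graph S A) = map_prod f f ` parcs G"
      unfolding S_graph_def by auto
    then show ?thesis
      by (simp add: app_iso_def with_proj_def h_def S_graph_def f(3))
  qed
  ultimately show "represents S G A"
    using f(2,3) pair_finite_verts unfolding represents_def digraph_iso_def by auto
qed

section \<open>Rescaling and translating one side of a cut\<close>

text \<open>
  Within \<open>U\<close> all differences are kept, and within \<open>W\<close> they are multiplied by the unit \<open>w\<close>; only pairs
  across the cut need hypotheses.  It suffices to control them in one direction because the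
  graph is symmetric and -1 is a unit.
\<close>

lemma realizes_glue:
  assumes S: "finite S" "\<forall>p\<in>S. prime p" and G: "pair_graph G"
    and f: "realizes S G f"
    and cut: "U \<union> W = pverts G" "U \<inter> W = {}"
    and w: "w \<in> S_units S" and b: "b \<in> S_integers S" and xy: "x \<in> U" "y \<in> W"
    and cross: "\<And>u v. u \<in> U \<Longrightarrow> v \<in> W \<Longrightarrow>
      (u, v) \<in> parcs G \<longleftrightarrow> w * (f v - f y) - (f u - f x) + b \<in> S_units S"
    and ne: "\<And>u v. u \<in> U \<Longrightarrow> v \<in> W \<Longrightarrow> w * (f v - f y) - (f u - f x) + b \<noteq> 0"
  shows "realizes S G (\<lambda>v. if v \<in> U then f v - f x else w * (f v - f y) + b)" (is "realizes S G ?g")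
proof -
  interpret pair_graph G by fact
  note closure = S_integer_mult[OF S] S_integer_add[OF S] S_integer_diff[OF S]
  have inj: "inj_on f (pverts G)" and ints: "\<And>v. v \<in> pverts G \<Longrightarrow> f v \<in> S_integers S"
    and arcs: "\<And>u v. u \<in> pverts G \<Longrightarrow> v \<in> pverts G \<Longrightarrow> (u, v) \<in> parcs G \<longleftrightarrow> f u - f v \<in> S_units S"
    using f unfolding realizes_def by auto
  have w': "w \<noteq> 0" "w \<in> S_integers S"
    using S_unit_inverse(2)[OF S w] w unfolding S_units_def by auto
  have sym: "(u, v) \<in> parcs G \<longleftrightarrow> (v, u) \<in> parcs G" for u v
    using pair_sym_arcs by (metis arcs_symmetric)
  have W: "v \<notin> U" if "v \<in> W" for v
    using that cut(2) by blast
  have diff: "?g v - ?g u = w * (f v - f y) - (f u - f x) + b" if "u \<in> U" "v \<in> W" for u v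
    using that W by simp
  have diff': "?g u - ?g v = - (w * (f v - f y) - (f u - f x) + b)" if "u \<in> U" "v \<in> W" for u v
    using that W by simp
  have scaled: "?g u - ?g v = w * (f u - f v)" if "u \<in> W" "v \<in> W" for u v
    using that W by (simp add: algebra_simps)
  have "u = v" if uv: "u \<in> pverts G" "v \<in> pverts G" and eq: "?g u = ?g v" for u v
  proof -
    have neq: "?g u \<noteq> ?g v" if "u \<in> U" "v \<in> W" for u v
    proof
      assume "?g u = ?g v"
      then have "?g v - ?g u = 0"
        by (simp only: right_minus_eq)
      then show False
        unfolding diff[OF that] using ne[OF that] by (rule notE[rotated])
    qed
    consider "u \<in> U" "v \<in> U" | "u \<in> W" "v \<in> W" | "u \<in> U" "v \<in> W" | "u \<in> W" "v \<in> U"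
      using uv unfolding cut(1)[symmetric] by blast
    then have "f u = f v"
    proof cases
      case 1
      then show ?thesis using eq by simp
    next
      case 2
      then have "w * (f u - f v) = 0"
        unfolding scaled[OF 2, symmetric] eq by simp
      then show ?thesis using w' by simp
    next
      case 3
      from neq[OF this] eq show ?thesis by (rule notE)
    next
      case 4
      from neq[OF this(2,1)] eq[symmetric] show ?thesis by (rule notE)
    qed
    then show "u = v"
      using inj uv by (simp add: inj_on_eq_iff)
  qed
  then have "inj_on ?g (pverts G)"
    by (auto intro!: inj_onI)
  moreover have "?g v \<in> S_integers S" if "v \<in> pverts G" for v
    using that ints xy cut(1) w' b by (auto intro!: closure)
  moreover have "(u, v) \<in> parcs G \<longleftrightarrow> ?g u - ?g v \<in> S_units S"
    if uv: "u \<in> pverts G" "v \<in> pverts G" for u v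
  proof -
    consider "u \<in> U" "v \<in> U" | "u \<in> W" "v \<in> W" | "u \<in> U" "v \<in> W" | "u \<in> W" "v \<in> U"
      using uv unfolding cut(1)[symmetric] by blast
    then show ?thesis
    proof cases
      case 1
      then show ?thesis using arcs[OF uv] by simp
    next
      case 2
      then show ?thesis using arcs[OF uv] scaled[of u v] S_unit_mult_cancel[OF S w] by simp
    next
      case 3
      then show ?thesis
        unfolding diff'[OF 3] S_unit_uminus[OF S] by (rule cross)
    next
      case 4
      then show ?thesis
        unfolding diff[OF 4(2,1)] using cross[OF 4(2,1)] sym by simp
    qed
  qed
  ultimately show ?thesis
    unfolding realizes_def by blast
qed

text \<open>Only the finitely many quotients \<open>a / b\<close> have to be avoided.\<close>

lemma ex_power_scaling_disjoint:
  fixes c :: "'a :: field"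
  assumes "finite X" "finite Y" "inj (\<lambda>j::nat. c ^ j)"
  shows "\<exists>j. \<forall>a\<in>X. \<forall>b\<in>Y. b \<noteq> 0 \<longrightarrow> c ^ j * b \<noteq> a"
proof -
  let ?Q = "(\<lambda>(a, b). a / b) ` (X \<times> Y)"
  have "finite ((\<lambda>j. c ^ j) -` ?Q)"
    using assms by (intro finite_vimageI) auto
  then obtain j where "c ^ j \<notin> ?Q"
    using ex_new_if_finite[of "(\<lambda>j. c ^ j) -` ?Q"] by auto
  then have "\<forall>a\<in>X. \<forall>b\<in>Y. b \<noteq> 0 \<longrightarrow> c ^ j * b \<noteq> a"
    by (force simp: field_simps)
  then show ?thesis ..
qed

theorem theorem4p2:
  fixes G :: "'a pair_pre_digraph" and S :: "nat set"
  assumes "pair_graph G"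
    and "card (pverts G) \<ge> 3"
    and "at_most_simply_connected G"
    and "finite S" and "S \<noteq> {}" and "\<forall>p \<in> S. prime p"
    and "representable S G"
  shows "infinitely_representable S G"
proof -
  interpret pair_graph G by fact
  note S = \<open>finite S\<close> \<open>\<forall>p \<in> S. prime p\<close>
  note closure = S_integer_mult[OF S] S_integer_add[OF S] S_integer_diff[OF S]
  let ?V = "pverts G" and ?P = "of_nat (\<Prod>S) :: rat"
  have repr: "represents S G A \<longleftrightarrow> (\<exists>f. realizes S G f \<and> A = f ` ?V)" for A
    by (rule represents_iff_realizes) unfold_locales
  obtain f where f: "realizes S G f"
    using \<open>representable S G\<close> repr unfolding representable_def by blast
  then have inj: "inj_on f ?V" and ints: "\<And>v. v \<in> ?V \<Longrightarrow> f v \<in> S_integers S"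
    unfolding realizes_def by auto
  have "?V \<noteq> {}"
    using assms(2) by auto
  with assms(3) obtain U W x y where xy: "x \<in> U" "y \<in> W" and cut: "U \<union> W = ?V" "U \<inter> W = {}"
    and bridge: "\<forall>u\<in>U. \<forall>v\<in>W. (u, v) \<in> parcs G \<longrightarrow> u = x \<and> v = y"
    by (rule at_most_simply_connected_imp_cut) (rule that)
  have fin: "finite U" "finite W"
    using pair_finite_verts cut(1) by (auto intro: finite_subset)
  have P: "\<Prod>S \<ge> 2"
    using Prod_ge_2[OF S \<open>S \<noteq> {}\<close>] .
  have power_inj: "inj (\<lambda>k. ?P ^ k)"
    using P by (intro injI) (simp del: of_nat_prod)

  \<comment> \<open>If \<open>f v - f y\<close> and \<open>f u - f x\<close> coincided for another pair than \<open>(x, y)\<close>, the shift by a unit would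
    create a second crossing edge; scaling one side excludes this.\<close>
  obtain j where "\<forall>a \<in> (\<lambda>u. f u - f x) ` U. \<forall>b \<in> (\<lambda>v. f v - f y) ` W. b \<noteq> 0 \<longrightarrow> ?P ^ j * b \<noteq> a"
    using ex_power_scaling_disjoint[OF _ _ power_inj, of "(\<lambda>u. f u - f x) ` U" "(\<lambda>v. f v - f y) ` W"] fin
    by auto
  then have j: "?P ^ j * (f v - f y) \<noteq> f u - f x" if "u \<in> U" "v \<in> W" "f v \<noteq> f y" for u v
    using that by auto
  define w where "w = ?P ^ j"
  have w: "w \<in> S_units S"
    unfolding w_def by (rule Prod_power_S_unit[OF S])
  then have w': "w \<noteq> 0" "w \<in> S_integers S"
    using S_unit_inverse(2)[OF S w] unfolding S_units_def by auto
  define c where "c u v = w * (f v - f y) - (f u - f x)" for u v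
  have c_int: "c u v \<in> S_integers S" if "u \<in> U" "v \<in> W" for u v
    using that xy cut(1) w'(2) ints unfolding c_def by (auto intro!: closure)
  have c_0: "u = x \<and> v = y" if "u \<in> U" "v \<in> W" "c u v = 0" for u v
  proof -
    have "f v = f y"
      using j[OF that(1,2)] that(3) by (auto simp: c_def w_def)
    moreover from this have "f u = f x"
      using that(3) by (simp add: c_def)
    ultimately show ?thesis
      using inj that xy cut(1) by (auto dest: inj_onD)
  qed

  \<comment> \<open>The difference at \<open>(x, y)\<close> is the shift itself, so it has to be a unit exactly when \<open>xy\<close> is
    an edge.  The number \<open>P + 1\<close> is prime to \<open>P\<close> and greater than 1.\<close>
  define m where "m = (if (x, y) \<in> parcs G then 1 else int (\<Prod>S) + 1)"
  have m: "coprime m (int (\<Prod>S))" "m > 0" "\<bar>m\<bar> = 1 \<longleftrightarrow> (x, y) \<in> parcs G"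
    using P by (auto simp: m_def simp del: of_nat_prod)
  define b where "b k = of_int m / ?P ^ k" for k
  have b_inj: "k = l" if "b k = b l" for k l
  proof -
    have "?P ^ k = ?P ^ l"
      using that m(2) unfolding b_def divide_cancel_left by simp
    then show ?thesis
      by (rule injD[OF power_inj])
  qed
  have b_int: "b k \<in> S_integers S" for k
  proof -
    have "inverse (?P ^ k) \<in> S_integers S"
      using S_unit_inverse(1)[OF S Prod_power_S_unit[OF S]] unfolding S_units_def by blast
    then show ?thesis
      using closure(1)[OF of_int_S_integer[OF S, of m]] by (simp add: b_def divide_inverse)
  qed

  have "\<forall>\<^sub>F k in sequentially. \<forall>u\<in>U. \<forall>v\<in>W.
      (c u v = 0 \<longrightarrow> \<bar>m\<bar> \<noteq> 1) \<longrightarrow> c u v + b k \<notin> S_units S \<and> c u v + b k \<noteq> 0"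
  proof (intro eventually_ball_finite fin ballI)
    fix u v assume "u \<in> U" "v \<in> W"
    then show "\<forall>\<^sub>F k in sequentially.
        (c u v = 0 \<longrightarrow> \<bar>m\<bar> \<noteq> 1) \<longrightarrow> c u v + b k \<notin> S_units S \<and> c u v + b k \<noteq> 0"
      using eventually_shift_not_S_unit[OF S \<open>S \<noteq> {}\<close> c_int m(1)] unfolding b_def
      by (cases "c u v = 0 \<longrightarrow> \<bar>m\<bar> \<noteq> 1") auto
  qed
  then obtain K where K: "c u v + b k \<notin> S_units S" "c u v + b k \<noteq> 0"
    if "k \<ge> K" "u \<in> U" "v \<in> W" "c u v = 0 \<longrightarrow> \<bar>m\<bar> \<noteq> 1" for k u v
    unfolding eventually_sequentially by metis
  define g where "g k v = (if v \<in> U then f v - f x else w * (f v - f y) + b k)" for k v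

  have g: "realizes S G (g k)" if k: "k \<ge> K" for k
    unfolding g_def
  proof (rule realizes_glue[OF S \<open>pair_graph G\<close> f cut w b_int xy])
    fix u v assume uv: "u \<in> U" "v \<in> W"
    have "((u, v) \<in> parcs G \<longleftrightarrow> c u v + b k \<in> S_units S) \<and> c u v + b k \<noteq> 0"
    proof (cases "c u v = 0 \<longrightarrow> \<bar>m\<bar> \<noteq> 1")
      case True
      have "(u, v) \<notin> parcs G"
      proof
        assume arc: "(u, v) \<in> parcs G"
        then have "u = x \<and> v = y"
          using bridge uv by blast
        then show False
          using arc True m(3) by (simp add: c_def)
      qed
      with K[OF k uv True] show ?thesis
        by blast
    next
      case False
      then have "u = x" "v = y" and arc: "(u, v) \<in> parcs G" and "m = 1"
        using c_0[OF uv] m by auto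
      moreover have "b k \<in> S_units S" "b k \<noteq> 0"
        using S_unit_inverse[OF S Prod_power_S_unit[OF S, of k]] \<open>m = 1\<close> P
        by (auto simp: b_def divide_inverse simp del: of_nat_prod)
      ultimately show ?thesis
        by (simp add: c_def)
    qed
    then show "(u, v) \<in> parcs G \<longleftrightarrow> w * (f v - f y) - (f u - f x) + b k \<in> S_units S"
      and "w * (f v - f y) - (f u - f x) + b k \<noteq> 0"
      by (simp_all add: c_def)
  qed

  \<comment> \<open>The label of \<open>x\<close> is always 0, so \<open>\<beta> = 0\<close>.  A third vertex \<open>z\<close> forms a pair with \<open>x\<close> or with \<open>y\<close>
    on the same side; their difference does not depend on \<open>k\<close>, so \<open>\<alpha> = 1\<close>.  The label of \<open>y\<close> is
    \<open>b k\<close>, which determines \<open>k\<close>.\<close>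
  have inequiv: "k = l" if "\<And>v. v \<in> ?V \<Longrightarrow> g l v = \<alpha> * g k v + \<beta>" for k l \<alpha> \<beta>
  proof -
    have "g l x = \<alpha> * g k x + \<beta>" "g l y = \<alpha> * g k y + \<beta>"
      using that xy cut(1) by blast+
    moreover have "y \<notin> U"
      using xy cut(2) by blast
    ultimately have "\<beta> = 0" and y: "b l = \<alpha> * b k"
      using xy(1) by (simp_all add: g_def)
    have "card {x, y} \<le> 2"
      by (simp add: card_insert_if)
    then have "\<not> ?V \<subseteq> {x, y}"
      using assms(2) card_mono[of "{x, y}" ?V] by fastforce
    then obtain z where z: "z \<in> ?V" "z \<noteq> x" "z \<noteq> y"
      by blast
    then have fz: "f z \<noteq> f x" "f z \<noteq> f y"
      using inj_on_eq_iff[OF inj z(1)] xy cut(1) by blast+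
    have gz: "g l z = \<alpha> * g k z"
      using that[OF z(1)] \<open>\<beta> = 0\<close> by simp
    have "\<alpha> = 1"
    proof (cases "z \<in> U")
      case True
      then show ?thesis
        using gz fz by (simp add: g_def)
    next
      case False
      then have "w * (f z - f y) + b l = \<alpha> * (w * (f z - f y)) + \<alpha> * b k"
        using gz by (simp add: g_def distrib_left)
      then have "w * (f z - f y) = \<alpha> * (w * (f z - f y))"
        unfolding y by (rule add_right_imp_eq)
      then show ?thesis
        using w'(1) fz by simp
    qed
    then show "k = l"
      using y b_inj by simp
  qed

  obtain vs where vs: "distinct vs" "set vs = ?V"
    using finite_distinct_list pair_finite_verts by blast
  let ?A = "\<lambda>k. map (g k) vs"
  have equiv: "k = l" if equiv: "S_equivalent S (?A k) (?A l)" for k l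
  proof -
    obtain \<alpha> \<beta> where "?A l = map (\<lambda>a. \<alpha> * a + \<beta>) (?A k)"
      using equiv unfolding S_equivalent_def by blast
    then have "\<And>v. v \<in> ?V \<Longrightarrow> g l v = \<alpha> * g k v + \<beta>"
      using vs(2) by (simp add: map_eq_conv)
    then show ?thesis
      by (rule inequiv)
  qed
  have "inj_on ?A {K..}"
  proof (rule inj_onI)
    fix k l assume "?A k = ?A l"
    then have "\<And>v. v \<in> ?V \<Longrightarrow> g l v = 1 * g k v + 0"
      using vs(2) by simp
    then show "k = l"
      by (rule inequiv)
  qed
  then have "infinite (?A ` {K..})"
    using infinite_Ici finite_imageD by blast
  moreover have "distinct A \<and> represents S G (set A)" if A: "A \<in> ?A ` {K..}" for A
  proof -
    obtain k where k: "K \<le> k" "A = ?A k"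
      using A by auto
    have "inj_on (g k) ?V"
      using g[OF k(1)] by (simp add: realizes_def)
    then have "distinct A" "set A = g k ` ?V"
      using vs by (simp_all add: k(2) distinct_map)
    then show ?thesis
      using g[OF k(1)] repr by blast
  qed
  moreover have "pairwise (\<lambda>A A'. \<not> S_equivalent S A A') (?A ` {K..})"
    using equiv unfolding pairwise_def by blast
  ultimately show ?thesis
    unfolding infinitely_representable_def by blast
qed

end
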